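(* Let $G$ be a pair of $d$-dimensional layer-permuted butterflies. For every set $A$ of input nodes and every set $B$ of output nodes of $G$ with $|A|=|B|$, there exist node-disjoint paths from $A$ to $B$. (Equivalently, $G$ is a superconcentrator.)
   Context: A $d$-dimensional layer-permuted butterfly with permutation $\pi$ of $\{1,\dots,d\}$ is the directed graph whose nodes are the pairs $(i,b)$ with $i\in\{0,1,\dots,d\}$ (the layer) and $b=b_1b_2\cdots b_d\in\{0,1\}^d$ (the label). For each $1\le i\le d$ and each $b$ there is a directed edge from $(i-1,b)$ to each of the two nodes $(i,b')$ where $b'$ agrees with $b$ in every coordinate except possibly coordinate $\pi(i)$. When $\pi$ is the identity this is the standard $d$-dimensional butterfly. Layer-$0$ nodes are input nodes and layer-$d$ nodes are output nodes. A pair of $d$-dimensional layer-permuted butterflies is obtained from two $d$-dimensional layer-permuted butterflies $G_1$ (permutation $\pi$) and $G_2$ (permutation $\sigma$), which may differ, by identifying the output node of $G_1$ with label $x$ with the input node of $G_2$ with label $x$, for every $x\in\{0,1\}^d$. The result has layers $0,\dots,2d$: layer $j$ of $G_2$ becomes layer $d+j$. Its input nodes are the input nodes of $G_1$ (layer $0$) and its output nodes are the output nodes of $G_2$ (layer $2d$). For a set $A$ of input nodes and a set $B$ of output nodes with $|A|=|B|$, "node-disjoint paths from $A$ to $B$" means $|A|$ directed paths, each starting at a node of $A$ and ending at a node of $B$, such that no two paths share a node and no path repeats a node. Consequently every node of $A$ starts exactly one path and every node of $B$ ends exactly one path. A graph with designated inputs and outputs is a superconcentrator if such paths exist for all $A$,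 $B$ with $|A|=|B|$. *)

theory Defs
  imports
    "HOL-Library.FuncSet"
    "HOL-Combinatorics.Permutations"
    "Graph_Theory.Pair_Digraph"
    "Graph_Theory.Vertex_Walk"
begin

text \<open>
  A label \<open>b\<^sub>1 b\<^sub>2 \<dots> b\<^sub>d \<in> {0,1}\<^sup>d\<close> is the extensional function \<open>b\<close> on \<open>{1..d}\<close>
  (\<open>True\<close> stands for \<open>1\<close>); a node is a pair of a layer and a label.
\<close>

type_synonym label = "nat \<Rightarrow> bool"

type_synonym node = "nat \<times> label"

definition labels :: "nat \<Rightarrow> label set" where
  "labels d = {1..d} \<rightarrow>\<^sub>E UNIV"

definition layer_permuted_butterfly :: "nat \<Rightarrow> (nat \<Rightarrow> nat) \<Rightarrow> node pair_pre_digraph" where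
  "layer_permuted_butterfly d \<pi> =
     \<lparr> pverts = {0..d} \<times> labels d,
       parcs = {((i - 1, b), (i, b')) | i b b'.
                  i \<in> {1..d} \<and> b \<in> labels d \<and> b' \<in> labels d \<and>
                  (\<forall>j \<in> {1..d}. j \<noteq> \<pi> i \<longrightarrow> b' j = b j)} \<rparr>"

definition shift_layers :: "nat \<Rightarrow> node pair_pre_digraph \<Rightarrow> node pair_pre_digraph" where
  "shift_layers k G =
     \<lparr> pverts = (\<lambda>(i, b). (k + i, b)) ` pverts G,
       parcs = (\<lambda>((i, b), (j, c)). ((k + i, b), (k + j, c))) ` parcs G \<rparr>"

text \<open>
  After moving the second butterfly up by \<open>d\<close> layers, its input with label \<open>x\<close> is literally the
  node \<open>(d, x)\<close>, which is also the output of the first one with label \<open>x\<close>; no other nodes coincide.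
  So the union of the two graphs performs exactly the required identification.
\<close>

definition butterfly_pair ::
    "nat \<Rightarrow> (nat \<Rightarrow> nat) \<Rightarrow> (nat \<Rightarrow> nat) \<Rightarrow> node pair_pre_digraph" where
  "butterfly_pair d \<pi> \<sigma> =
     (let G1 = layer_permuted_butterfly d \<pi>;
          G2 = shift_layers d (layer_permuted_butterfly d \<sigma>)
      in \<lparr> pverts = pverts G1 \<union> pverts G2, parcs = parcs G1 \<union> parcs G2 \<rparr>)"

definition layer :: "node pair_pre_digraph \<Rightarrow> nat \<Rightarrow> node set" where
  "layer G i = {v \<in> pverts G. fst v = i}"

abbreviation pair_inputs :: "nat \<Rightarrow> (nat \<Rightarrow> nat) \<Rightarrow> (nat \<Rightarrow> nat) \<Rightarrow> node set" where
  "pair_inputs d \<pi> \<sigma> \<equiv> layer (butterfly_pair d \<pi> \<sigma>) 0"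

abbreviation pair_outputs :: "nat \<Rightarrow> (nat \<Rightarrow> nat) \<Rightarrow> (nat \<Rightarrow> nat) \<Rightarrow> node set" where
  "pair_outputs d \<pi> \<sigma> \<equiv> layer (butterfly_pair d \<pi> \<sigma>) (2 * d)"

text \<open>
  Paths are given by their node lists (there are no parallel arcs); \<open>vpath\<close> includes that no node
  is repeated, and allows a single node as a path, which is needed for \<open>d = 0\<close>.
  Finiteness of \<open>P\<close> matters for \<open>card A = 0\<close> only.
\<close>

definition node_disjoint_paths ::
    "'a pair_pre_digraph \<Rightarrow> 'a set \<Rightarrow> 'a set \<Rightarrow> 'a list set \<Rightarrow> bool" where
  "node_disjoint_paths G A B P \<longleftrightarrow>
     finite P \<and> card P = card A \<and>
     (\<forall>p \<in> P. vpath p (with_proj G) \<and> hd p \<in> A \<and> last p \<in> B) \<and>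
     (\<forall>p \<in> P. \<forall>q \<in> P. p \<noteq> q \<longrightarrow> set p \<inter> set q = {})"

end

theory Submission
  imports Defs
begin

text \<open>
  The first layer of a butterfly splits it into two smaller butterflies, according to the value of
  one coordinate. Two inputs differing only in that coordinate are sent to different halves, and
  every other input may choose its half; so a set of inputs can be divided in any way in which
  the two parts differ by at most one. Iterating this, every set \<open>A\<close> of inputs can be joined to every
  set \<open>C\<close> of outputs of the same size that is balanced: for each \<open>j\<close>, the numbers of elements of \<open>C\<close>
  in the subcubes obtained by fixing the coordinates \<open>\<pi> 1, \<dots>, \<pi> j\<close> differ by at most one.
  By symmetry, \<open>B\<close> can be joined to \<open>C\<close> through the second butterfly if \<open>C\<close> is balanced
  for the coordinate order \<open>\<sigma> d, \<dots>, \<sigma> 1\<close>.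

  A set \<open>C\<close> of given size that is balanced for both orders exists: pairing the points
  of the cube that differ only in the last coordinate of either order gives two perfect matchings,
  whose union is 2-colourable. Each colour class is a transversal of both matchings and is
  treated recursively; \<open>C\<close> lies in one class, or contains one class and part of the other.
\<close>

section \<open>Common bisections of two perfect matchings\<close>

text \<open>The edges \<open>{x, a x}\<close> and \<open>{x, b x}\<close> form cycles in which the
  two matchings alternate; these cycles are even, and \<open>H\<close> takes every other point. The
  induction needs no cycles: it deletes one \<open>a\<close>-edge and repairs \<open>b\<close> on
  the remaining points.\<close>

lemma two_involutions_bisection:
  fixes a b :: "'a \<Rightarrow> 'a"
  assumes "finite X"
    and "\<And>x. x \<in> X \<Longrightarrow> a x \<in> X \<and> a (a x) = x \<and> a x \<noteq> x"
    and "\<And>x. x \<in> X \<Longrightarrow> b x \<in> X \<and> b (b x) = x \<and> b x \<noteq> x"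
  shows "\<exists>H\<subseteq>X. \<forall>x\<in>X. (a x \<in> H \<longleftrightarrow> x \<notin> H) \<and> (b x \<in> H \<longleftrightarrow> x \<notin> H)"
  using assms
proof (induction "card X" arbitrary: X b rule: less_induct)
  case less
  note fin = less.prems(1) and a = less.prems(2) and b = less.prems(3)
  show ?case
  proof (cases "X = {}")
    case False
    then obtain x where x: "x \<in> X" by blast
    define y where "y = a x"
    define X' where "X' = X - {x, y}"
    have y: "y \<in> X" "a y = x" "y \<noteq> x" using a[OF x] by (auto simp: y_def)
    have lt: "card X' < card X" "finite X'"
      using fin x by (auto simp: X'_def intro: psubset_card_mono)
    have a': "a z \<in> X' \<and> a (a z) = z \<and> a z \<noteq> z" if "z \<in> X'" for z
      using that a[of z] y x by (auto simp: X'_def y_def)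
    \<comment> \<open>If \<open>b\<close> also matches \<open>x\<close> with \<open>y\<close>, these
      two points are a component of their own and their colours do not affect the rest.\<close>
    show ?thesis
    proof (cases "b x = y")
      case True
      have b': "b z \<in> X' \<and> b (b z) = z \<and> b z \<noteq> z" if "z \<in> X'" for z
        using that b[of z] b[OF x] True by (auto simp: X'_def)
      obtain H where H: "H \<subseteq> X'"
        "\<forall>z\<in>X'. (a z \<in> H \<longleftrightarrow> z \<notin> H) \<and> (b z \<in> H \<longleftrightarrow> z \<notin> H)"
        using less.hyps[of X' b, OF lt a' b'] by auto
      have "b y = x" using b[OF x] True by auto
      then have "(a z \<in> insert x H \<longleftrightarrow> z \<notin> insert x H) \<and>
          (b z \<in> insert x H \<longleftrightarrow> z \<notin> insert x H)" if z: "z \<in> X" for z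
      proof -
        have yH: "y \<notin> insert x H" using H(1) y(3) by (auto simp: X'_def)
        consider "z = x" | "z = y" | "z \<in> X'" using z by (auto simp: X'_def)
        then show ?thesis
        proof cases
          case 3
          then have "a z \<noteq> x" "b z \<noteq> x" "z \<noteq> x" using a'[of z] b'[of z] by (auto simp: X'_def)
          then show ?thesis using H(2) 3 by simp
        qed (use \<open>b y = x\<close> True y yH in \<open>simp_all add: y_def[symmetric]\<close>)
      qed
      moreover have "insert x H \<subseteq> X" using H x by (auto simp: X'_def)
      ultimately show ?thesis by blast
    next
      case False
      define u v where "u = b x" and "v = b y"
      have uv: "u \<in> X'" "v \<in> X'" "u \<noteq> v" "b u = x" "b v = y"
        using b[OF x] b[OF y(1)] False y(3) by (auto simp: X'_def u_def v_def)
      text \<open>Contract the path \<open>u, x, y, v\<close> of alternating matching edges to the single edge \<open>u, v\<close>.\<close>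
      define b' where "b' = b(u := v, v := u)"
      have b': "b' z \<in> X' \<and> b' (b' z) = z \<and> b' z \<noteq> z" if "z \<in> X'" for z
      proof (cases "z = u \<or> z = v")
        case True
        then show ?thesis using uv by (auto simp: b'_def)
      next
        case False
        have z: "z \<in> X" "z \<noteq> x" "z \<noteq> y" using that by (auto simp: X'_def)
        have "b z \<noteq> u" "b z \<noteq> v" "b z \<noteq> x" "b z \<noteq> y"
          using b[OF z(1)] False z(2,3) uv(4,5) u_def v_def by auto
        then show ?thesis using False b[OF z(1)] by (simp add: b'_def X'_def)
      qed
      obtain H where H: "H \<subseteq> X'"
        "\<forall>z\<in>X'. (a z \<in> H \<longleftrightarrow> z \<notin> H) \<and> (b' z \<in> H \<longleftrightarrow> z \<notin> H)"
        using less.hyps[of X' b', OF lt a' b'] by auto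
      have uvH: "u \<in> H \<longleftrightarrow> v \<notin> H" using bspec[OF H(2) uv(1)] uv(3) by (simp add: b'_def)
      \<comment> \<open>The contracted edge gives \<open>u\<close> and \<open>v\<close> opposite
        colours, so giving \<open>x\<close> the colour opposite to \<open>u\<close> and
        \<open>y\<close> the colour opposite to \<open>v\<close> also separates \<open>x\<close>
        from \<open>y\<close>.\<close>
      define K where "K = (if u \<in> H then insert y H else insert x H)"
      have KX': "z \<in> K \<longleftrightarrow> z \<in> H" if "z \<in> X'" for z
        using that by (auto simp: K_def X'_def)
      have xy: "x \<in> K \<longleftrightarrow> u \<notin> H" "y \<in> K \<longleftrightarrow> u \<in> H"
        using H(1) y(3) by (auto simp: K_def X'_def)
      have "(a z \<in> K \<longleftrightarrow> z \<notin> K) \<and> (b z \<in> K \<longleftrightarrow> z \<notin> K)" if z: "z \<in> X" for z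
      proof -
        consider "z = x" | "z = y" | "z = u" | "z = v" | "z \<in> X'" "z \<noteq> u" "z \<noteq> v"
          using z by (auto simp: X'_def)
        then show ?thesis
        proof cases
          case 1 then show ?thesis using xy KX' uv by (simp add: y_def[symmetric] u_def[symmetric])
        next
          case 2 then show ?thesis using xy KX' uv uvH y by (simp add: v_def[symmetric])
        next
          case 3 then show ?thesis using xy KX' uv a'[of u] bspec[OF H(2) uv(1)] by simp
        next
          case 4 then show ?thesis using xy KX' uv a'[of v] bspec[OF H(2) uv(2)] uvH by simp
        next
          case 5
          then have "b z \<in> X'" "b' z = b z" using b'[of z] by (auto simp: b'_def)
          then show ?thesis using 5 KX' a'[of z] bspec[OF H(2) 5(1)] by simp
        qed
      qed
      moreover have "K \<subseteq> X" using H(1) x y by (auto simp: K_def X'_def)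
      ultimately show ?thesis by blast
    qed
  qed auto
qed

text \<open>The matching sends each point to the other point of its fibre.\<close>

lemma involution_of_fibres_of_size_two:
  assumes "\<And>x. x \<in> X \<Longrightarrow> card {z \<in> X. f z = f x} = 2"
  obtains a where "\<And>x. x \<in> X \<Longrightarrow> a x \<in> X \<and> a (a x) = x \<and> a x \<noteq> x" "\<And>x. x \<in> X \<Longrightarrow> f (a x) = f x"
proof -
  define a where "a x = (THE y. y \<in> X \<and> f y = f x \<and> y \<noteq> x)" for x
  have ex1: "\<exists>!y. y \<in> X \<and> f y = f x \<and> y \<noteq> x" if x: "x \<in> X" for x
  proof -
    obtain p q where pq: "{z \<in> X. f z = f x} = {p, q}" "p \<noteq> q"
      using assms[OF x] by (auto simp: card_2_iff)
    have "x \<in> {z \<in> X. f z = f x}" using x by simp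
    then have "{y. y \<in> X \<and> f y = f x \<and> y \<noteq> x} = {if x = p then q else p}"
      using pq by auto
    then have "y \<in> X \<and> f y = f x \<and> y \<noteq> x \<longleftrightarrow> y = (if x = p then q else p)" for y
      by (simp only: set_eq_iff mem_Collect_eq singleton_iff)
    then show ?thesis by simp
  qed
  have a: "a x \<in> X \<and> f (a x) = f x \<and> a x \<noteq> x" if "x \<in> X" for x
    unfolding a_def using theI'[OF ex1[OF that]] .
  have "a (a x) = x" if "x \<in> X" for x
    using a[OF that] a[of "a x"] ex1[of "a x"] that by metis
  then show thesis using a that by blast
qed

text \<open>Since \<open>a\<close> preserves the fibres of \<open>f\<close> and exchanges
  \<open>H\<close> with its complement, it is a bijection between the two parts of each
  fibre.\<close>

lemma card_fibre_bisected:
  assumes fin: "finite X" and H: "H \<subseteq> X" "\<forall>x\<in>X. a x \<in> H \<longleftrightarrow> x \<notin> H"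
    and a: "\<And>x. x \<in> X \<Longrightarrow> a x \<in> X \<and> a (a x) = x \<and> a x \<noteq> x"
    and f: "\<And>x. x \<in> X \<Longrightarrow> f (a x) = f x"
  shows "card {z \<in> X. f z = v} = 2 * card {z \<in> H. f z = v}"
    and "card {z \<in> X. f z = v} = 2 * card {z \<in> X - H. f z = v}"
proof -
  have "bij_betw a {z \<in> H. f z = v} {z \<in> X - H. f z = v}"
    by (rule bij_betw_byWitness[where f' = a]) (use H a f in auto)
  then have eq: "card {z \<in> H. f z = v} = card {z \<in> X - H. f z = v}" by (rule bij_betw_same_card)
  have "{z \<in> X. f z = v} = {z \<in> H. f z = v} \<union> {z \<in> X - H. f z = v}" using H by auto
  moreover have "finite {z \<in> H. f z = v}" "finite {z \<in> X - H. f z = v}"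
    using fin H by (auto intro: finite_subset)
  ultimately have "card {z \<in> X. f z = v} = card {z \<in> H. f z = v} + card {z \<in> X - H. f z = v}"
    by (simp add: card_Un_disjoint disjoint_iff)
  with eq show "card {z \<in> X. f z = v} = 2 * card {z \<in> H. f z = v}"
    "card {z \<in> X. f z = v} = 2 * card {z \<in> X - H. f z = v}" by auto
qed

section \<open>Sets balanced for two chains of partitions\<close>

text \<open>The representatives \<open>x\<close>, \<open>y\<close> come from \<open>X\<close> and
  not from \<open>C\<close>, so that fibres missed by \<open>C\<close> count as well.\<close>

definition balanced_on :: "('a \<Rightarrow> 'b) \<Rightarrow> 'a set \<Rightarrow> 'a set \<Rightarrow> bool" where
  "balanced_on f X C \<longleftrightarrow>
     (\<forall>x\<in>X. \<forall>y\<in>X. card {z \<in> C. f z = f x} \<le> card {z \<in> C. f z = f y} + 1)"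

text \<open>Models the partitions of the cube into the subcubes that fix the first \<open>j\<close>
  coordinates of an order. The abstract form is needed for the recursion: a half \<open>H\<close> is
  in general no subcube, but it inherits this structure with one level less.\<close>

definition binary_refinement :: "nat \<Rightarrow> (nat \<Rightarrow> 'a \<Rightarrow> 'b) \<Rightarrow> 'a set \<Rightarrow> bool" where
  "binary_refinement n f X \<longleftrightarrow>
     (\<forall>j\<le>n. \<forall>x\<in>X. card {z \<in> X. f j z = f j x} = 2 ^ (n - j)) \<and>
     (\<forall>j<n. \<forall>x\<in>X. \<forall>y\<in>X. f (Suc j) x = f (Suc j) y \<longrightarrow> f j x = f j y)"

lemma binary_refinementD:
  assumes "binary_refinement n f X"
  shows "\<And>j x. j \<le> n \<Longrightarrow> x \<in> X \<Longrightarrow> card {z \<in> X. f j z = f j x} = 2 ^ (n - j)"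
    and "\<And>j x y. j < n \<Longrightarrow> x \<in> X \<Longrightarrow> y \<in> X \<Longrightarrow> f (Suc j) x = f (Suc j) y \<Longrightarrow> f j x = f j y"
  using assms unfolding binary_refinement_def by blast+

lemma binary_refinement_coarser:
  assumes "binary_refinement n f X" "j \<le> i" "i \<le> n" "x \<in> X" "y \<in> X" "f i x = f i y"
  shows "f j x = f j y"
  using assms(2-)
proof (induction i rule: dec_induct)
  case (step m)
  have "f m x = f m y" using binary_refinementD(2)[OF assms(1), of m x y] step by simp
  then show ?case using step by simp
qed auto

lemma balanced_on_superset:
  assumes "balanced_on f H C" "\<And>x. x \<in> X \<Longrightarrow> \<exists>x'\<in>H. f x' = f x"
  shows "balanced_on f X C"
  unfolding balanced_on_def
proof (intro ballI)
  fix x y assume "x \<in> X" "y \<in> X"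
  then obtain x' y' where "x' \<in> H" "f x' = f x" "y' \<in> H" "f y' = f y" using assms(2) by blast
  then show "card {z \<in> C. f z = f x} \<le> card {z \<in> C. f z = f y} + 1"
    using assms(1) unfolding balanced_on_def by force
qed

text \<open>As \<open>a\<close> stays inside the fibres of \<open>f n\<close>, it stays inside those
  of every coarser \<open>f j\<close>. So each such fibre is cut in half, and each half of
  \<open>X\<close> meets all of them; this is why balance on a half passes to
  \<open>X\<close>.\<close>

lemma binary_refinement_halves:
  assumes ref: "binary_refinement (Suc n) f X" and fin: "finite X"
    and H: "H \<subseteq> X" "\<forall>x\<in>X. a x \<in> H \<longleftrightarrow> x \<notin> H"
    and a: "\<And>x. x \<in> X \<Longrightarrow> a x \<in> X \<and> a (a x) = x \<and> a x \<noteq> x"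
    and f: "\<And>x. x \<in> X \<Longrightarrow> f n (a x) = f n x"
  shows "binary_refinement n f H" "binary_refinement n f (X - H)"
    and "\<And>j x. j \<le> n \<Longrightarrow> x \<in> X \<Longrightarrow> card {z \<in> H. f j z = f j x} = 2 ^ (n - j)"
    and "\<And>j C. j \<le> n \<Longrightarrow> balanced_on (f j) H C \<Longrightarrow> balanced_on (f j) X C"
    and "\<And>j C. j \<le> n \<Longrightarrow> balanced_on (f j) (X - H) C \<Longrightarrow> balanced_on (f j) X C"
proof -
  have fj: "f j (a x) = f j x" if "j \<le> n" "x \<in> X" for j x
    using binary_refinement_coarser[OF ref, of j n "a x" x] that f a by auto
  have X: "card {z \<in> X. f j z = f j x} = 2 * 2 ^ (n - j)" if "j \<le> n" "x \<in> X" for j x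
    using binary_refinementD(1)[OF ref, of j x] that by (simp add: Suc_diff_le)
  have cards: "card {z \<in> H. f j z = f j x} = 2 ^ (n - j)"
    "card {z \<in> X - H. f j z = f j x} = 2 ^ (n - j)" if "j \<le> n" "x \<in> X" for j x
    using X[OF that] card_fibre_bisected[of X H a "f j" "f j x", OF fin H a fj] that by auto
  then show "\<And>j x. j \<le> n \<Longrightarrow> x \<in> X \<Longrightarrow> card {z \<in> H. f j z = f j x} = 2 ^ (n - j)" by blast
  show "binary_refinement n f H" "binary_refinement n f (X - H)"
    using binary_refinementD(2)[OF ref] H(1) cards unfolding binary_refinement_def
    by (meson Diff_iff less_SucI subsetD)+
  show "balanced_on (f j) X C" if "j \<le> n" "balanced_on (f j) H C" for j C
  proof (rule balanced_on_superset[OF that(2)])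
    fix x assume "x \<in> X"
    then show "\<exists>x'\<in>H. f j x' = f j x" using fj[OF \<open>j \<le> n\<close>, of x] H by blast
  qed
  show "balanced_on (f j) X C" if "j \<le> n" "balanced_on (f j) (X - H) C" for j C
  proof (rule balanced_on_superset[OF that(2)])
    fix x assume "x \<in> X"
    then show "\<exists>x'\<in>X - H. f j x' = f j x" using fj[OF \<open>j \<le> n\<close>, of x] H(2) a[of x] by blast
  qed
qed

text \<open>Adding \<open>H\<close> raises all fibre counts by the same \<open>m\<close>, which
  leaves their differences unchanged.\<close>

lemma balanced_on_add_transversal:
  assumes "balanced_on f X C" "\<And>x. x \<in> X \<Longrightarrow> card {z \<in> H. f z = f x} = m"
    "finite H" "finite C" "H \<inter> C = {}"
  shows "balanced_on f X (H \<union> C)"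
proof -
  have "card {z \<in> H \<union> C. f z = f x} = m + card {z \<in> C. f z = f x}" if "x \<in> X" for x
  proof -
    have "{z \<in> H \<union> C. f z = f x} = {z \<in> H. f z = f x} \<union> {z \<in> C. f z = f x}" by auto
    then show ?thesis
      using assms(2)[OF that] assms(3-5) by (simp add: card_Un_disjoint disjoint_iff)
  qed
  then show ?thesis using assms(1) unfolding balanced_on_def by auto
qed

text \<open>On the finest level the fibres are single points, so all counts are 0 or 1.\<close>

lemma balanced_on_discrete:
  assumes "binary_refinement n f X" "C \<subseteq> X" "finite X"
  shows "balanced_on (f n) X C"
proof -
  have "card {z \<in> C. f n z = f n x} \<le> 1" if "x \<in> X" for x
  proof -
    have "card {z \<in> C. f n z = f n x} \<le> card {z \<in> X. f n z = f n x}"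
      using assms by (intro card_mono) auto
    then show ?thesis using binary_refinementD(1)[OF assms(1), of n x] that by simp
  qed
  then show ?thesis unfolding balanced_on_def by (meson le_add2 order_trans)
qed

lemma doubly_balanced_subset:
  fixes f :: "nat \<Rightarrow> 'a \<Rightarrow> 'b" and g :: "nat \<Rightarrow> 'a \<Rightarrow> 'c"
  assumes "card X = 2 ^ n" "binary_refinement n f X" "binary_refinement n g X" "k \<le> 2 ^ n"
  shows "\<exists>C\<subseteq>X. card C = k \<and> (\<forall>j\<le>n. balanced_on (f j) X C \<and> balanced_on (g j) X C)"
  using assms
proof (induction n arbitrary: X k)
  case 0
  then have fin: "finite X" by (intro card_ge_0_finite) simp
  obtain C where "C \<subseteq> X" "card C = k"
    using 0 by (metis obtain_subset_with_card_n power_0)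
  then show ?case using balanced_on_discrete[OF 0(2) _ fin] balanced_on_discrete[OF 0(3) _ fin] by auto
next
  case (Suc n)
  note ref = Suc.prems(2,3)
  have fin: "finite X" using Suc.prems by (intro card_ge_0_finite) simp
  have two: "card {z \<in> X. f n z = f n x} = 2" "card {z \<in> X. g n z = g n x} = 2" if "x \<in> X" for x
    using binary_refinementD(1)[OF ref(1), of n x] binary_refinementD(1)[OF ref(2), of n x] that
    by simp_all
  obtain a where a: "\<And>x. x \<in> X \<Longrightarrow> a x \<in> X \<and> a (a x) = x \<and> a x \<noteq> x" "\<And>x. x \<in> X \<Longrightarrow> f n (a x) = f n x"
    using involution_of_fibres_of_size_two[of X "f n", OF two(1)] by blast
  obtain b where b: "\<And>x. x \<in> X \<Longrightarrow> b x \<in> X \<and> b (b x) = x \<and> b x \<noteq> x" "\<And>x. x \<in> X \<Longrightarrow> g n (b x) = g n x"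
    using involution_of_fibres_of_size_two[of X "g n", OF two(2)] by blast
  obtain H where H: "H \<subseteq> X" "\<forall>x\<in>X. a x \<in> H \<longleftrightarrow> x \<notin> H" "\<forall>x\<in>X. b x \<in> H \<longleftrightarrow> x \<notin> H"
    using two_involutions_bisection[of X a b, OF fin a(1) b(1)] by blast
  note F = binary_refinement_halves[of n f X H a, OF ref(1) fin H(1,2) a]
  note G = binary_refinement_halves[of n g X H b, OF ref(2) fin H(1,3) b]
  have finH: "finite H" using H fin finite_subset by blast
  \<comment> \<open>A constant function has \<open>X\<close> as its only fibre.\<close>
  have cardH: "card H = 2 ^ n" "card (X - H) = 2 ^ n"
    using card_fibre_bisected[of X H a "\<lambda>_. ()" "()", OF fin H(1,2) a(1)] Suc.prems(1)
    by (auto simp: set_diff_eq)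
  \<comment> \<open>The halves control only the levels up to \<open>n\<close>; level
    \<open>Suc n\<close> is discrete and is added at the end.\<close>
  obtain C where C: "C \<subseteq> X" "card C = k" "\<forall>j\<le>n. balanced_on (f j) X C \<and> balanced_on (g j) X C"
  proof (cases "k \<le> 2 ^ n")
    case True
    obtain C where "C \<subseteq> H" "card C = k" "\<forall>j\<le>n. balanced_on (f j) H C \<and> balanced_on (g j) H C"
      using Suc.IH[OF cardH(1) F(1) G(1) True] by blast
    then show thesis using that[of C] F(4) G(4) H(1) by blast
  next
    case False
    then have "k - 2 ^ n \<le> 2 ^ n" using Suc.prems(4) by simp
    then obtain C where C: "C \<subseteq> X - H" "card C = k - 2 ^ n"
      "\<forall>j\<le>n. balanced_on (f j) (X - H) C \<and> balanced_on (g j) (X - H) C"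
      using Suc.IH[OF cardH(2) F(2) G(2)] by blast
    have finC: "finite C" using C(1) fin finite_subset by blast
    have disj: "H \<inter> C = {}" using C(1) by auto
    show thesis
    proof (rule that[of "H \<union> C"])
      show "H \<union> C \<subseteq> X" using C(1) H(1) by auto
      show "card (H \<union> C) = k" using finH finC disj cardH(1) C(2) False by (simp add: card_Un_disjoint)
      show "\<forall>j\<le>n. balanced_on (f j) X (H \<union> C) \<and> balanced_on (g j) X (H \<union> C)"
        using balanced_on_add_transversal[OF F(5) F(3) finH finC disj]
          balanced_on_add_transversal[OF G(5) G(3) finH finC disj] C(3) by blast
    qed
  qed
  then show ?case
    using balanced_on_discrete[OF ref(1) _ fin] balanced_on_discrete[OF ref(2) _ fin]
    by (metis le_SucE)
qed

section \<open>Routing along a single coordinate\<close>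

lemma restrict_eq_restrict_iff: "restrict x J = restrict y J \<longleftrightarrow> (\<forall>i\<in>J. x i = y i)"
  by (auto simp: restrict_def fun_eq_iff)

text \<open>Points whose \<open>flip\<close> is also in \<open>S\<close> stay where they are, so
  each such pair contributes one point to either side. The unpaired points \<open>U\<close> choose
  their side freely. Since \<open>m0\<close> and \<open>m1\<close> differ by at most one and add up
  to \<open>2 * card P1 + card U\<close>, the target \<open>m1\<close> lies between
  \<open>card P1\<close> and \<open>card P1 + card U\<close>.\<close>

lemma split_along_coordinate:
  fixes S :: "('i \<Rightarrow> bool) set"
  assumes fin: "finite S" and m: "m0 + m1 = card S" "m0 \<le> m1 + 1" "m1 \<le> m0 + 1"
  shows "\<exists>h. inj_on h S \<and> (\<forall>z\<in>S. \<forall>i. i \<noteq> c \<longrightarrow> h z i = z i) \<and> card {z \<in> S. h z c} = m1"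
proof -
  define flip where "flip z = z(c := \<not> z c)" for z :: "'i \<Rightarrow> bool"
  have flip: "flip (flip z) = z" "flip z c \<longleftrightarrow> \<not> z c" for z by (auto simp: flip_def)
  define P1 where "P1 = {z \<in> S. flip z \<in> S \<and> z c}"
  define P0 where "P0 = {z \<in> S. flip z \<in> S \<and> \<not> z c}"
  define U where "U = {z \<in> S. flip z \<notin> S}"
  have finite: "finite P0" "finite P1" "finite U" using fin by (auto simp: P0_def P1_def U_def)
  have "bij_betw flip P0 P1"
    by (rule bij_betw_byWitness[where f' = flip]) (auto simp: P0_def P1_def flip)
  then have P: "card P0 = card P1" by (rule bij_betw_same_card)
  have S: "S = P0 \<union> P1 \<union> U" by (auto simp: P0_def P1_def U_def)
  have "card (P0 \<union> P1 \<union> U) = card P0 + card P1 + card U"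
    using finite by (subst card_Un_disjoint, (auto simp: P0_def P1_def U_def)[3],
      subst card_Un_disjoint) (auto simp: P0_def P1_def)
  then have cardS: "card S = 2 * card P1 + card U" using P S by simp
  then have "m1 - card P1 \<le> card U" using m by linarith
  \<comment> \<open>\<open>V\<close> consists of the unpaired points sent to the side where
    coordinate \<open>c\<close> is \<open>True\<close>.\<close>
  then obtain V where V: "V \<subseteq> U" "card V = m1 - card P1"
    using obtain_subset_with_card_n by metis
  define h where "h z = (if z \<in> U then z(c := z \<in> V) else z)" for z
  have h_cases: "h z = z \<or> z \<in> U \<and> h z = flip z" for z
    by (auto simp: h_def flip_def fun_eq_iff)
  \<comment> \<open>Distinct points can collide only if one is the \<open>flip\<close> of the other
    and one of them lies in \<open>U\<close>, but \<open>U\<close> excludes points whose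
    \<open>flip\<close> is in \<open>S\<close>.\<close>
  have "inj_on h S"
  proof (rule inj_onI)
    fix z w assume zw: "z \<in> S" "w \<in> S" "h z = h w"
    then have "z = w \<or> z = flip w \<and> w \<in> U \<or> w = flip z \<and> z \<in> U"
      using h_cases[of z] h_cases[of w] flip by metis
    then show "z = w" using zw by (auto simp: U_def)
  qed
  moreover have "\<forall>z\<in>S. \<forall>i. i \<noteq> c \<longrightarrow> h z i = z i" by (simp add: h_def)
  moreover have "card {z \<in> S. h z c} = m1"
  proof -
    have "{z \<in> S. h z c} = P1 \<union> V"
      using V(1) by (auto simp: h_def P1_def U_def split: if_splits)
    moreover have "card (P1 \<union> V) = card P1 + card V"
      using V(1) finite finite_subset[OF V(1)] by (intro card_Un_disjoint) (auto simp: P1_def U_def)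
    moreover have "card P1 \<le> m1" using cardS m by linarith
    ultimately show ?thesis using V(2) by simp
  qed
  ultimately show ?thesis by blast
qed

text \<open>The map \<open>h\<close> is arbitrary, so that the same count serves the points of
  \<open>C\<close> (with the identity) and the routed points of \<open>S\<close>.\<close>

lemma card_split_coordinate:
  fixes S :: "('i \<Rightarrow> bool) set" and h :: "('i \<Rightarrow> bool) \<Rightarrow> 'i \<Rightarrow> bool"
  assumes "finite S" "c \<notin> I"
  shows "card {z \<in> S. restrict (h z) I = restrict x I} =
    card {z \<in> S. restrict (h z) (insert c I) = restrict (x(c := False)) (insert c I)} +
    card {z \<in> S. restrict (h z) (insert c I) = restrict (x(c := True)) (insert c I)}"
proof -
  have I: "\<forall>i\<in>I. i \<noteq> c" using assms(2) by auto
  have "{z \<in> S. restrict (h z) I = restrict x I} =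
    {z \<in> S. restrict (h z) (insert c I) = restrict (x(c := False)) (insert c I)} \<union>
    {z \<in> S. restrict (h z) (insert c I) = restrict (x(c := True)) (insert c I)}"
    using I by (auto simp: restrict_eq_restrict_iff)
  then show ?thesis
    using assms(1) by (simp only:) (rule card_Un_disjoint; auto simp: restrict_eq_restrict_iff)
qed

text \<open>Each subcube fixing the coordinates in \<open>I\<close> is split separately, with the
  counts of \<open>C\<close> in its two halves as targets; \<open>bal\<close> says that these differ
  by at most one. The resulting maps glue injectively because they leave the coordinates in
  \<open>I\<close> alone.\<close>

lemma route_one_coordinate:
  fixes S C :: "('i \<Rightarrow> bool) set"
  assumes fin: "finite S" "finite C" and c: "c \<notin> I"
    and eq: "\<And>x. card {z \<in> S. restrict z I = restrict x I} = card {z \<in> C. restrict z I = restrict x I}"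
    and bal: "\<And>x y. card {z \<in> C. restrict z (insert c I) = restrict x (insert c I)}
      \<le> card {z \<in> C. restrict z (insert c I) = restrict y (insert c I)} + 1"
  shows "\<exists>h. inj_on h S \<and> (\<forall>z\<in>S. \<forall>i. i \<noteq> c \<longrightarrow> h z i = z i) \<and>
    (\<forall>x. card {z \<in> S. restrict (h z) (insert c I) = restrict x (insert c I)} =
         card {z \<in> C. restrict z (insert c I) = restrict x (insert c I)})"
proof -
  let ?cube = "\<lambda>x. {z \<in> S. restrict z I = restrict x I}"
  let ?m = "\<lambda>x t. card {z \<in> C. restrict z (insert c I) = restrict (x(c := t)) (insert c I)}"
  have "\<exists>h. inj_on h (?cube x) \<and> (\<forall>z\<in>?cube x. \<forall>i. i \<noteq> c \<longrightarrow> h z i = z i) \<and>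
      card {z \<in> ?cube x. h z c} = ?m x True" for x
    using eq[of x] card_split_coordinate[OF fin(2) c, of "\<lambda>z. z" x] bal fin
    by (intro split_along_coordinate[where ?m0.0 = "?m x False"]) simp_all
  then have "\<exists>H. \<forall>x. inj_on (H x) (?cube x) \<and> (\<forall>z\<in>?cube x. \<forall>i. i \<noteq> c \<longrightarrow> H x z i = z i) \<and>
      card {z \<in> ?cube x. H x z c} = ?m x True"
    by (intro choice allI)
  then obtain H where H: "\<And>x. inj_on (H x) (?cube x)"
    "\<And>x z i. z \<in> ?cube x \<Longrightarrow> i \<noteq> c \<Longrightarrow> H x z i = z i"
    "\<And>x. card {z \<in> ?cube x. H x z c} = ?m x True"
    by blast
  \<comment> \<open>\<open>restrict z I\<close> is a canonical representative of the subcube of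
    \<open>z\<close>, so all points of one subcube use the same map.\<close>
  define h where "h z = H (restrict z I) z" for z
  have h_off: "h z i = z i" if "z \<in> S" "i \<noteq> c" for z i
    using H(2)[of z "restrict z I" i] that by (simp add: h_def)
  have h_I: "restrict (h z) I = restrict z I" if "z \<in> S" for z
    unfolding restrict_eq_restrict_iff using h_off[OF that] c by metis
  have "inj_on h S"
  proof (rule inj_onI)
    fix z w assume zw: "z \<in> S" "w \<in> S" "h z = h w"
    then have r: "restrict z I = restrict w I" using h_I by metis
    then have "H (restrict z I) z = H (restrict z I) w" using zw(3) by (simp add: h_def)
    then show "z = w" using H(1)[of "restrict z I"] zw(1,2) r by (auto dest: inj_onD)
  qed
  moreover have "card {z \<in> S. restrict (h z) (insert c I) = restrict x (insert c I)} =
      card {z \<in> C. restrict z (insert c I) = restrict x (insert c I)}" for x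
  proof -
    let ?n = "\<lambda>t. card {z \<in> S. restrict (h z) (insert c I) = restrict (x(c := t)) (insert c I)}"
    have sub: "restrict (h z) (insert c I) = restrict (x(c := True)) (insert c I) \<longleftrightarrow>
        restrict z I = restrict x I \<and> H (restrict x I) z c" if "z \<in> S" for z
    proof -
      have "restrict (h z) (insert c I) = restrict (x(c := True)) (insert c I) \<longleftrightarrow>
        restrict (h z) I = restrict x I \<and> h z c"
        using c by (auto simp: restrict_eq_restrict_iff)
      then show ?thesis using h_I[OF that] by (auto simp: h_def)
    qed
    have "{z \<in> S. restrict (h z) (insert c I) = restrict (x(c := True)) (insert c I)} =
        {z \<in> ?cube (restrict x I). H (restrict x I) z c}"
      using sub by auto
    moreover have "restrict ((restrict x I)(c := True)) (insert c I) = restrict (x(c := True)) (insert c I)"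
      by (auto simp: restrict_eq_restrict_iff)
    ultimately have "?n True = ?m x True" using H(3)[of "restrict x I"] by simp
    \<comment> \<open>The count for \<open>False\<close> follows from the one for
      \<open>True\<close>, since the totals over the undivided subcube agree by
      \<open>eq\<close>.\<close>
    moreover have "?n False + ?n True = ?m x False + ?m x True"
    proof -
      have "?n False + ?n True = card {z \<in> S. restrict (h z) I = restrict x I}"
        using card_split_coordinate[OF fin(1) c, of h x] by simp
      also have "{z \<in> S. restrict (h z) I = restrict x I} = ?cube x" using h_I by auto
      also have "card (?cube x) = ?m x False + ?m x True"
        using eq[of x] card_split_coordinate[OF fin(2) c, of "\<lambda>z. z" x] by simp
      finally show ?thesis .
    qed
    ultimately have "?n (x c) = ?m x (x c)" by (cases "x c") auto
    then show ?thesis by simp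
  qed
  ultimately show ?thesis using h_off by blast
qed

section \<open>Routing through all layers of one butterfly\<close>

lemma finite_labels [simp]: "finite (labels d)"
  unfolding labels_def by (intro finite_PiE) auto

lemma card_labels_agreeing:
  assumes "J \<subseteq> {1..d}"
  shows "card {z \<in> labels d. restrict z J = restrict x J} = 2 ^ (d - card J)"
proof -
  have "{z \<in> labels d. restrict z J = restrict x J} =
      PiE {1..d} (\<lambda>i. if i \<in> J then {x i} else UNIV)"
  proof (rule set_eqI)
    fix z :: label
    have "(\<forall>i\<in>{1..d}. z i \<in> (if i \<in> J then {x i} else UNIV)) \<longleftrightarrow> (\<forall>i\<in>J. z i = x i)"
      using assms by auto
    then show "z \<in> {z \<in> labels d. restrict z J = restrict x J} \<longleftrightarrow>
        z \<in> PiE {1..d} (\<lambda>i. if i \<in> J then {x i} else UNIV)"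
      unfolding labels_def PiE_iff restrict_eq_restrict_iff mem_Collect_eq
      by (simp add: conj_commute)
  qed
  then have "card {z \<in> labels d. restrict z J = restrict x J} = (\<Prod>i\<in>{1..d}. if i \<in> J then 1 else 2)"
    by (simp add: card_PiE) (intro prod.cong; simp)
  also have "\<dots> = 2 ^ card ({1..d} - J)"
    by (simp add: prod.If_cases set_diff_eq Int_def)
  also have "card ({1..d} - J) = d - card J"
    using assms by (simp add: card_Diff_subset finite_subset)
  finally show ?thesis .
qed

lemma card_labels: "card (labels d) = 2 ^ d"
  by (simp add: labels_def card_PiE)

lemma binary_refinement_labels:
  assumes "\<alpha> permutes {1..d}"
  shows "binary_refinement d (\<lambda>j z. restrict z (\<alpha> ` {1..j})) (labels d)"
  unfolding binary_refinement_def
proof (intro conjI allI impI ballI)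
  fix j and x :: label assume "j \<le> d"
  then have "\<alpha> ` {1..j} \<subseteq> {1..d}" using permutes_image[OF assms] by auto
  moreover have "card (\<alpha> ` {1..j}) = j"
    using card_image[OF permutes_inj_on[OF assms]] by simp
  ultimately show "card {z \<in> labels d. restrict z (\<alpha> ` {1..j}) = restrict x (\<alpha> ` {1..j})} = 2 ^ (d - j)"
    using card_labels_agreeing by simp
next
  fix j and x y :: label assume "restrict x (\<alpha> ` {1..Suc j}) = restrict y (\<alpha> ` {1..Suc j})"
  then show "restrict x (\<alpha> ` {1..j}) = restrict y (\<alpha> ` {1..j})"
    by (auto simp: restrict_eq_restrict_iff)
qed

text \<open>\<open>r j a\<close> is the label reached in layer \<open>j\<close> from the input
  \<open>a\<close>. Layer by layer, each subcube fixing the first \<open>j\<close> coordinates is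
  made to hold as many routed points as points of \<open>C\<close>. When all coordinates are fixed
  the subcubes are points, so the routed points are exactly \<open>C\<close>.\<close>

lemma route_to_balanced_set:
  assumes \<alpha>: "\<alpha> permutes {1..d}" and A: "A \<subseteq> labels d" and C: "C \<subseteq> labels d"
    and card: "card A = card C"
    and bal: "\<And>j. j \<le> d \<Longrightarrow> balanced_on (\<lambda>z. restrict z (\<alpha> ` {1..j})) (labels d) C"
  shows "\<exists>r. (\<forall>a\<in>A. r 0 a = a) \<and> (\<forall>j\<le>d. inj_on (r j) A) \<and> (\<forall>j\<le>d. \<forall>a\<in>A. r j a \<in> labels d) \<and>
    (\<forall>j<d. \<forall>a\<in>A. \<forall>i. i \<noteq> \<alpha> (Suc j) \<longrightarrow> r (Suc j) a i = r j a i) \<and> r d ` A = C"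
proof -
  have fin: "finite A" "finite C" using A C finite_labels finite_subset by blast+
  \<comment> \<open>Fibres are determined by coordinates in \<open>{1..d}\<close>, so balance
    extends from labels to arbitrary functions \<open>x\<close>, \<open>y\<close>.\<close>
  have bal': "card {z \<in> C. restrict z (\<alpha> ` {1..j}) = restrict x (\<alpha> ` {1..j})}
      \<le> card {z \<in> C. restrict z (\<alpha> ` {1..j}) = restrict y (\<alpha> ` {1..j})} + 1" if "j \<le> d" for j x y
  proof -
    have "\<alpha> ` {1..j} \<subseteq> {1..d}" using permutes_image[OF \<alpha>] that by auto
    then have r: "restrict (restrict v {1..d}) (\<alpha> ` {1..j}) = restrict v (\<alpha> ` {1..j})" for v :: label
      by (simp add: Int_absorb1)
    have "restrict v {1..d} \<in> labels d" for v :: label by (simp add: labels_def)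
    then show ?thesis
      using bspec[OF bspec[OF bal[OF that, unfolded balanced_on_def]], of "restrict x {1..d}" "restrict y {1..d}"]
      unfolding r by blast
  qed
  have "\<exists>r. (\<forall>a\<in>A. r 0 a = a) \<and> (\<forall>j\<le>m. inj_on (r j) A \<and> (\<forall>a\<in>A. r j a \<in> labels d)) \<and>
      (\<forall>j<m. \<forall>a\<in>A. \<forall>i. i \<noteq> \<alpha> (Suc j) \<longrightarrow> r (Suc j) a i = r j a i) \<and>
      (\<forall>x. card {z \<in> r m ` A. restrict z (\<alpha> ` {1..m}) = restrict x (\<alpha> ` {1..m})} =
           card {z \<in> C. restrict z (\<alpha> ` {1..m}) = restrict x (\<alpha> ` {1..m})})" if "m \<le> d" for m
    using that
  proof (induction m)
    case 0
    \<comment> \<open>With no coordinate fixed there is one subcube, and the invariant reduces to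
      \<open>card A = card C\<close>.\<close>
    show ?case by (rule exI[of _ "\<lambda>_ a. a"]) (use A card in \<open>auto simp: restrict_def\<close>)
  next
    case (Suc m)
    from Suc.prems have "m \<le> d" by simp
    from Suc.IH[OF this] obtain r where r0: "\<forall>a\<in>A. r 0 a = a"
      and r1: "\<forall>j\<le>m. inj_on (r j) A \<and> (\<forall>a\<in>A. r j a \<in> labels d)"
      and r2: "\<forall>j<m. \<forall>a\<in>A. \<forall>i. i \<noteq> \<alpha> (Suc j) \<longrightarrow> r (Suc j) a i = r j a i"
      and r3: "\<And>x. card {z \<in> r m ` A. restrict z (\<alpha> ` {1..m}) = restrict x (\<alpha> ` {1..m})} =
           card {z \<in> C. restrict z (\<alpha> ` {1..m}) = restrict x (\<alpha> ` {1..m})}"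
      by blast
    have ins: "\<alpha> ` {1..Suc m} = insert (\<alpha> (Suc m)) (\<alpha> ` {1..m})"
      by (simp add: atLeastAtMostSuc_conv)
    have new: "\<alpha> (Suc m) \<notin> \<alpha> ` {1..m}"
      by (auto simp: inj_eq[OF permutes_inj[OF \<alpha>]])
    note step = route_one_coordinate[of "r m ` A" C "\<alpha> (Suc m)" "\<alpha> ` {1..m}", folded ins,
        OF finite_imageI[OF fin(1)] fin(2) new r3 bal'[OF Suc.prems]]
    obtain h where h: "inj_on h (r m ` A)" "\<forall>z\<in>r m ` A. \<forall>i. i \<noteq> \<alpha> (Suc m) \<longrightarrow> h z i = z i"
      "\<forall>x. card {z \<in> r m ` A. restrict (h z) (\<alpha> ` {1..Suc m}) = restrict x (\<alpha> ` {1..Suc m})} =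
         card {z \<in> C. restrict z (\<alpha> ` {1..Suc m}) = restrict x (\<alpha> ` {1..Suc m})}"
      using step by blast
    define r' where "r' = r(Suc m := \<lambda>a. h (r m a))"
    have lab: "h (r m a) \<in> labels d" if "a \<in> A" for a
    proof -
      have "r m a \<in> labels d" using r1 that by simp
      moreover have "\<alpha> (Suc m) \<in> {1..d}" using permutes_in_image[OF \<alpha>, of "Suc m"] Suc.prems by simp
      moreover have "h (r m a) i = r m a i" if "i \<noteq> \<alpha> (Suc m)" for i
        using h(2) \<open>a \<in> A\<close> that by simp
      ultimately show ?thesis by (auto simp: labels_def PiE_iff extensional_def)
    qed
    have inj: "inj_on (\<lambda>a. h (r m a)) A"
      using comp_inj_on[of "r m" A h] h(1) r1 by (simp add: comp_def)
    show ?case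
    proof (intro exI[of _ r'] conjI allI impI)
      show "\<forall>a\<in>A. r' 0 a = a" using r0 by (simp add: r'_def)
    next
      fix j assume "j \<le> Suc m"
      then show "inj_on (r' j) A" "\<forall>a\<in>A. r' j a \<in> labels d"
        using r1 inj lab by (auto simp: r'_def le_Suc_eq)
    next
      fix j assume "j < Suc m"
      then show "\<forall>a\<in>A. \<forall>i. i \<noteq> \<alpha> (Suc j) \<longrightarrow> r' (Suc j) a i = r' j a i"
        using r2 h(2) by (auto simp: r'_def less_Suc_eq)
    next
      fix x :: label
      let ?P = "\<lambda>z. restrict z (\<alpha> ` {1..Suc m}) = restrict x (\<alpha> ` {1..Suc m})"
      have "{z \<in> r' (Suc m) ` A. ?P z} = h ` {z \<in> r m ` A. ?P (h z)}" by (auto simp: r'_def)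
      then have "card {z \<in> r' (Suc m) ` A. ?P z} = card {z \<in> r m ` A. ?P (h z)}"
        using card_image[of h "{z \<in> r m ` A. ?P (h z)}"] inj_on_subset[OF h(1)] by auto
      then show "card {z \<in> r' (Suc m) ` A. ?P z} = card {z \<in> C. ?P z}" using h(3) by simp
    qed
  qed
  from this[OF order_refl]
  obtain r where r: "\<forall>a\<in>A. r 0 a = a" "\<forall>j\<le>d. inj_on (r j) A \<and> (\<forall>a\<in>A. r j a \<in> labels d)"
    "\<forall>j<d. \<forall>a\<in>A. \<forall>i. i \<noteq> \<alpha> (Suc j) \<longrightarrow> r (Suc j) a i = r j a i"
    "\<forall>x. card {z \<in> r d ` A. restrict z {1..d} = restrict x {1..d}} =
         card {z \<in> C. restrict z {1..d} = restrict x {1..d}}"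
    unfolding permutes_image[OF \<alpha>] by blast
  have img: "r d ` A \<subseteq> labels d" using r(2) by auto
  \<comment> \<open>With all coordinates fixed the count is the indicator of \<open>S\<close>, so
    equal counts mean equal sets.\<close>
  have count: "card {z \<in> S. restrict z {1..d} = restrict x {1..d}} = (if x \<in> S then 1 else 0)"
    if "S \<subseteq> labels d" "x \<in> labels d" for S x
  proof -
    have "restrict z {1..d} = z" if "z \<in> labels d" for z
      using that by (simp add: labels_def PiE_iff extensional_restrict)
    then have "restrict z {1..d} = restrict x {1..d} \<longleftrightarrow> z = x" if "z \<in> S" for z
      using that \<open>S \<subseteq> labels d\<close> \<open>x \<in> labels d\<close> by (metis subsetD)
    then have "{z \<in> S. restrict z {1..d} = restrict x {1..d}} = (if x \<in> S then {x} else {})"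
      by auto
    then show ?thesis by simp
  qed
  have "x \<in> r d ` A \<longleftrightarrow> x \<in> C" if "x \<in> labels d" for x
    using spec[OF r(4), of x] count[OF img that] count[OF C that]
    by (cases "x \<in> r d ` A"; cases "x \<in> C") simp_all
  then have "r d ` A = C" using img C by blast
  then show ?thesis using r(1-3) by blast
qed

section \<open>From routings to node-disjoint paths\<close>

lemma set_vwalk_arcs_map_upt:
  "set (vwalk_arcs (map f [i..<n])) \<subseteq> {(f j, f (Suc j)) | j. i \<le> j \<and> Suc j < n}"
proof (induction "n - i" arbitrary: i)
  case (Suc k)
  show ?case
  proof (cases "Suc i < n")
    case True
    then have "map f [i..<n] = f i # f (Suc i) # map f [Suc (Suc i)..<n]"
      "map f [Suc i..<n] = f (Suc i) # map f [Suc (Suc i)..<n]"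
      by (simp_all add: upt_conv_Cons)
    then have "set (vwalk_arcs (map f [i..<n])) = insert (f i, f (Suc i)) (set (vwalk_arcs (map f [Suc i..<n])))"
      by simp
    also have "\<dots> \<subseteq> insert (f i, f (Suc i)) {(f j, f (Suc j)) | j. Suc i \<le> j \<and> Suc j < n}"
      using Suc.hyps(1)[of "Suc i"] Suc.hyps(2) by (intro insert_mono) simp
    also have "\<dots> \<subseteq> {(f j, f (Suc j)) | j. i \<le> j \<and> Suc j < n}"
      using True by (auto dest: Suc_leD)
    finally show ?thesis .
  next
    case False
    with Suc.hyps(2) have "[i..<n] = [i]" by (simp add: upt_conv_Cons)
    then show ?thesis by simp
  qed
qed simp

text \<open>Nodes carry their layer number. Hence no path repeats a node, and two paths could meet
  only within one layer, where injectivity of \<open>q j\<close> forbids it.\<close>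

lemma layered_node_disjoint_paths:
  assumes "finite L"
    and vert: "\<And>j a. j \<le> n \<Longrightarrow> a \<in> L \<Longrightarrow> (j, q j a) \<in> pverts G"
    and arc: "\<And>j a. j < n \<Longrightarrow> a \<in> L \<Longrightarrow> ((j, q j a), (Suc j, q (Suc j) a)) \<in> parcs G"
    and inj: "\<And>j. j \<le> n \<Longrightarrow> inj_on (q j) L"
    and "card A = card L" "\<And>a. a \<in> L \<Longrightarrow> (0, q 0 a) \<in> A" "\<And>a. a \<in> L \<Longrightarrow> (n, q n a) \<in> B"
  shows "\<exists>P. node_disjoint_paths G A B P"
proof -
  define p where "p a = map (\<lambda>j. (j, q j a)) [0..<Suc n]" for a
  have ends: "hd (p a) = (0, q 0 a)" "last (p a) = (n, q n a)" for a
    by (simp add: p_def hd_map del: upt_Suc) (simp add: p_def)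
  have disj: "set (p a) \<inter> set (p b) = {}" if "a \<in> L" "b \<in> L" "a \<noteq> b" for a b
    using that inj_onD[OF inj] by (fastforce simp: p_def less_Suc_eq_le simp del: upt_Suc)
  have "inj_on p L"
  proof (rule inj_onI)
    fix a b assume "a \<in> L" "b \<in> L" "p a = p b"
    then show "a = b" using disj[of a b] by (auto simp: p_def)
  qed
  moreover have "vpath (p a) (with_proj G)" if "a \<in> L" for a
  proof (intro vpathI vwalkI)
    show "set (p a) \<subseteq> verts (with_proj G)" using vert that by (auto simp: p_def simp del: upt_Suc)
    show "set (vwalk_arcs (p a)) \<subseteq> arcs_ends (with_proj G)"
      using set_vwalk_arcs_map_upt[of "\<lambda>j. (j, q j a)" 0 "Suc n"] arc that
      unfolding p_def with_proj_simps by blast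
    show "p a \<noteq> []" by (simp add: p_def)
    show "distinct (p a)" by (simp add: p_def distinct_map inj_on_def del: upt_Suc)
  qed
  ultimately have "node_disjoint_paths G A B (p ` L)"
    using assms(1,5-7) disj unfolding node_disjoint_paths_def
    by (simp add: card_image ends) metis
  then show ?thesis by blast
qed

section \<open>Nodes and arcs of the pair, and the joining of both routings\<close>

lemma mem_pverts_butterfly_pair:
  "(i, b) \<in> pverts (butterfly_pair d \<pi> \<sigma>) \<longleftrightarrow> i \<le> 2 * d \<and> b \<in> labels d"
proof -
  have "(i, b) \<in> (\<lambda>(i, b). (d + i, b)) ` ({0..d} \<times> labels d) \<longleftrightarrow> d \<le> i \<and> i \<le> 2 * d \<and> b \<in> labels d"
    by (auto simp: image_iff intro!: bexI[of _ "i - d"])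
  then show ?thesis
    by (auto simp: butterfly_pair_def layer_permuted_butterfly_def shift_layers_def)
qed

lemma layer_butterfly_pair:
  "i \<le> 2 * d \<Longrightarrow> layer (butterfly_pair d \<pi> \<sigma>) i = {i} \<times> labels d"
  by (auto simp: layer_def mem_pverts_butterfly_pair)

lemma layer_permuted_butterfly_arcI:
  assumes "i < d" "b \<in> labels d" "b' \<in> labels d" "\<And>j. j \<noteq> \<pi> (Suc i) \<Longrightarrow> b' j = b j"
  shows "((i, b), (Suc i, b')) \<in> parcs (layer_permuted_butterfly d \<pi>)"
  using assms unfolding layer_permuted_butterfly_def
  by (auto intro!: exI[of _ "Suc i"])

lemma butterfly_pair_first_arcI:
  assumes "i < d" "b \<in> labels d" "b' \<in> labels d" "\<And>j. j \<noteq> \<pi> (Suc i) \<Longrightarrow> b' j = b j"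
  shows "((i, b), (Suc i, b')) \<in> parcs (butterfly_pair d \<pi> \<sigma>)"
  using layer_permuted_butterfly_arcI[of i d b b' \<pi>, OF assms] by (simp add: butterfly_pair_def Let_def)

lemma butterfly_pair_second_arcI:
  assumes "i < d" "b \<in> labels d" "b' \<in> labels d" "\<And>j. j \<noteq> \<sigma> (Suc i) \<Longrightarrow> b' j = b j"
  shows "((d + i, b), (Suc (d + i), b')) \<in> parcs (butterfly_pair d \<pi> \<sigma>)"
  using imageI[OF layer_permuted_butterfly_arcI[of i d b b' \<sigma>, OF assms],
      of "\<lambda>((i, b), (j, c)). ((d + i, b), (d + j, c))"]
  by (simp add: butterfly_pair_def shift_layers_def Let_def)

theorem theorem2:
  fixes d :: nat and \<pi> \<sigma> :: "nat \<Rightarrow> nat" and A B :: "node set"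
  assumes "\<pi> permutes {1..d}"
    and "\<sigma> permutes {1..d}"
    and "A \<subseteq> pair_inputs d \<pi> \<sigma>"
    and "B \<subseteq> pair_outputs d \<pi> \<sigma>"
    and "card A = card B"
  shows "\<exists>P. node_disjoint_paths (butterfly_pair d \<pi> \<sigma>) A B P"
proof -
  define K where "K = snd ` A"
  define L where "L = snd ` B"
  have A: "A = {0} \<times> K" and K: "K \<subseteq> labels d"
    using assms(3) by (force simp: K_def layer_butterfly_pair)+
  have B: "B = {2 * d} \<times> L" and L: "L \<subseteq> labels d"
    using assms(4) by (force simp: L_def layer_butterfly_pair)+
  have card: "card K = card L" using assms(5) by (simp add: A B card_cartesian_product)
  have finK: "finite K" using finite_subset[OF K finite_labels] .
  \<comment> \<open>Reverses \<open>{1..d}\<close> and, as \<open>permutes\<close> demands, fixes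
    everything else; thus \<open>\<sigma> \<circ> \<rho>\<close> lists
    \<open>\<sigma> d, \<dots>, \<sigma> 1\<close>.\<close>
  define \<rho> where "\<rho> i = (if i \<in> {1..d} then d + 1 - i else i)" for i
  have "\<rho> permutes {1..d}"
  proof (rule bij_imp_permutes)
    show "bij_betw \<rho> {1..d} {1..d}"
      by (rule bij_betw_byWitness[where f' = \<rho>]) (auto simp: \<rho>_def)
  qed (auto simp: \<rho>_def)
  then have \<beta>: "\<sigma> \<circ> \<rho> permutes {1..d}" using assms(2) by (rule permutes_compose)
  have "card K \<le> 2 ^ d" using card_mono[OF finite_labels K] by (simp add: card_labels)
  note doubly_balanced_subset[OF card_labels binary_refinement_labels[OF assms(1)]
      binary_refinement_labels[OF \<beta>] this]
  then obtain C where C: "C \<subseteq> labels d" "card C = card K"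
    "\<And>j. j \<le> d \<Longrightarrow> balanced_on (\<lambda>z. restrict z (\<pi> ` {1..j})) (labels d) C"
    "\<And>j. j \<le> d \<Longrightarrow> balanced_on (\<lambda>z. restrict z ((\<sigma> \<circ> \<rho>) ` {1..j})) (labels d) C"
    by blast
  obtain r where r [rule_format]: "\<forall>a\<in>K. r 0 a = a" "\<forall>j\<le>d. inj_on (r j) K"
    "\<forall>j\<le>d. \<forall>a\<in>K. r j a \<in> labels d"
    "\<forall>j<d. \<forall>a\<in>K. \<forall>i. i \<noteq> \<pi> (Suc j) \<longrightarrow> r (Suc j) a i = r j a i"
    "r d ` K = C"
    using route_to_balanced_set[OF assms(1) K C(1) C(2)[symmetric] C(3)] by blast
  text \<open>The second butterfly is routed backwards from the outputs, hence in the order reversed by \<open>\<rho>\<close>.\<close>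
  obtain s where s [rule_format]: "\<forall>a\<in>L. s 0 a = a" "\<forall>j\<le>d. inj_on (s j) L"
    "\<forall>j\<le>d. \<forall>a\<in>L. s j a \<in> labels d"
    "\<forall>j<d. \<forall>a\<in>L. \<forall>i. i \<noteq> (\<sigma> \<circ> \<rho>) (Suc j) \<longrightarrow> s (Suc j) a i = s j a i"
    "s d ` L = C"
    using route_to_balanced_set[OF \<beta> L C(1) trans[OF card[symmetric] C(2)[symmetric]] C(4)] by blast
  \<comment> \<open>\<open>\<tau> a\<close> is the output label whose backward route reaches the
    middle layer at the same node as the forward route of \<open>a\<close>.\<close>
  define \<tau> where "\<tau> a = the_inv_into L (s d) (r d a)" for a
  have \<tau>: "\<tau> a \<in> L" "s d (\<tau> a) = r d a" if "a \<in> K" for a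
  proof -
    have "r d a \<in> s d ` L" using that r(5) s(5) by auto
    then show "\<tau> a \<in> L" "s d (\<tau> a) = r d a"
      using s(2)[of d] by (auto simp: \<tau>_def f_the_inv_into_f intro: the_inv_into_into)
  qed
  have inj_\<tau>: "inj_on \<tau> K"
  proof (rule inj_onI)
    fix a b assume ab: "a \<in> K" "b \<in> K" "\<tau> a = \<tau> b"
    then have "r d a = r d b" using \<tau>(2) by metis
    then show "a = b" using inj_onD[OF r(2)[of d]] ab by blast
  qed
  \<comment> \<open>At the middle layer the two routes agree, so \<open>q (d + j)\<close> can be
    read off the backward route for \<open>j = 0\<close> too, as \<open>q2\<close> states.\<close>
  define q where "q j a = (if j \<le> d then r j a else s (2 * d - j) (\<tau> a))" for j a
  have q2: "q (d + j) a = s (d - j) (\<tau> a)" if "a \<in> K" for j a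
    using \<tau>(2)[OF that] by (cases j) (auto simp: q_def)
  have lab: "q j a \<in> labels d" if "a \<in> K" for j a
    using that r(3) s(3) \<tau>(1) by (simp add: q_def)
  show ?thesis
  proof (rule layered_node_disjoint_paths[where L = K and n = "2 * d" and q = q])
    fix j a assume j: "j < 2 * d" and a: "a \<in> K"
    show "((j, q j a), (Suc j, q (Suc j) a)) \<in> parcs (butterfly_pair d \<pi> \<sigma>)"
    proof (cases "j < d")
      case True
      then show ?thesis
        using r(3)[OF _ a] r(4)[OF True a] by (auto simp: q_def intro!: butterfly_pair_first_arcI)
    next
      case False
      define i where "i = j - d"
      have i: "j = d + i" "i < d" using False j by (auto simp: i_def)
      \<comment> \<open>The arc from layer \<open>d + i\<close> to the next one reverses step
        \<open>d - i\<close> of the backward route, which changes coordinate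
        \<open>\<sigma> (\<rho> (d - i))\<close>, that is \<open>\<sigma> (Suc i)\<close>.\<close>
      have "\<rho> (Suc (d - Suc i)) = Suc i" using i(2) by (auto simp: \<rho>_def)
      moreover have "d - i = Suc (d - Suc i)" using i(2) by simp
      ultimately have "s (d - i) (\<tau> a) k = s (d - Suc i) (\<tau> a) k" if "k \<noteq> \<sigma> (Suc i)" for k
        using s(4)[of "d - Suc i" "\<tau> a" k] \<tau>(1)[OF a] that i(2) by simp
      then show ?thesis
        using butterfly_pair_second_arcI[OF i(2) lab[OF a, of "d + i"] lab[OF a, of "Suc (d + i)"], of \<sigma> \<pi>]
          q2[OF a, of i] q2[OF a, of "Suc i"] i(1) by simp
    qed
  next
    fix j assume "j \<le> 2 * d"
    show "inj_on (q j) K"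
    proof (cases "j \<le> d")
      case True then show ?thesis using r(2) by (simp add: q_def[abs_def])
    next
      case False
      then have "inj_on (s (2 * d - j)) L" using s(2) by simp
      then have "inj_on (s (2 * d - j)) (\<tau> ` K)" using \<tau>(1) by (auto intro: inj_on_subset)
      then have "inj_on (s (2 * d - j) \<circ> \<tau>) K" by (rule comp_inj_on[OF inj_\<tau>])
      then show ?thesis using False by (simp add: q_def[abs_def] comp_def)
    qed
  next
    fix a assume a: "a \<in> K"
    show "(0, q 0 a) \<in> A" using a r(1) by (simp add: A q_def)
    show "(2 * d, q (2 * d) a) \<in> B" using q2[OF a, of d] s(1) \<tau>(1)[OF a] by (simp add: B mult_2)
  qed (use finK lab in \<open>auto simp: A card_cartesian_product mem_pverts_butterfly_pair\<close>)
qed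

end
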